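(* Consider the convex program of minimizing $F(\mathbf{x})$ over $\mathbf{x}\in\mathcal{X}$ subject to $G_k(\mathbf{x})\le 0$ for $k\in\{1,\dots,m\}$, with the data and standing assumptions described in the context (the $g_k$ are possibly nonlinear). Let $\mathbf{x}^\ast$ be an optimal solution and let $\boldsymbol{\lambda}^\ast\ge\mathbf{0}$ be a Lagrange multiplier vector attaining strong duality (as defined in the context). Run the algorithm described in the context with the non-decreasing parameters $\alpha(0)=\frac12\big[\beta^2+L_f+[\mathbf{Q}(0)+\mathbf{G}(\mathbf{x}(-1))]^{T}\mathbf{L}_{\mathbf{g}}\big]$ and, for $t\ge1$, $$\alpha(t)=\max\Big\{\alpha(t-1),\ \tfrac12\big[\beta^2+L_f+[\mathbf{Q}(t)+\mathbf{G}(\mathbf{x}(t-1))]^{T}\mathbf{L}_{\mathbf{g}}\big]\Big\}.$$ Define $$\alpha^{\max}=\Big[\sqrt{\tfrac12\beta^2+\tfrac12L_f+\Vert\boldsymbol{\lambda}^\ast\Vert\Vert\mathbf{L}_{\mathbf{g}}\Vert+C\Vert\mathbf{L}_{\mathbf{g}}\Vert}+\tfrac{\sqrt2}{2}R\Vert\mathbf{L}_{\mathbf{g}}\Vert\Big]^2.$$ Then for all $t\ge1$: 1. $F(\overline{\mathbf{x}}(t))\le F(\mathbf{x}^\ast)+\frac{\alpha^{\max}}{t}R^2$. 2. For every $k\in\{1,\dots,m\}$, $G_k(\overline{\mathbf{x}}(t))\le\frac1t\big[2\Vert\boldsymbol{\lambda}^\ast\Vert+R\sqrt{2\alpha^{\max}}+C\big]$.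 That is, the errors decay like $O(1/t)$: there is a constant $K$ (independent of $t$ and $\epsilon$) such that for every $\epsilon>0$ and every integer $t\ge 1$ with $t\ge K/\epsilon$, $F(\overline{\mathbf{x}}(t))\le F(\mathbf{x}^\ast)+\epsilon$ and $G_k(\overline{\mathbf{x}}(t))\le\epsilon$ for all $k$.
   Context: Norm: $\Vert\cdot\Vert$ is the Euclidean norm. A function is separable if it is a sum of functions each involving disjoint components (or blocks) of $\mathbf{x}$. A function $\phi$ continuously differentiable on $\mathcal{X}$ is smooth on $\mathcal{X}$ with modulus $L\ge 0$ if $\nabla\phi$ is Lipschitz continuous on $\mathcal{X}$ with constant $L$. Problem: $n,m$ are positive integers and $\mathcal{X}\subseteq\mathbb{R}^n$ is a closed convex set. $F(\mathbf{x})=f(\mathbf{x})+\tilde f(\mathbf{x})$ with $f$ convex and smooth on $\mathcal{X}$ with modulus $L_f$, and $\tilde f$ convex and separable (possibly non-smooth) on $\mathcal{X}$. $G_k(\mathbf{x})=g_k(\mathbf{x})+\tilde g_k(\mathbf{x})$ for $k=1,\dots,m$, with $g_k$ convex, Lipschitz continuous and smooth on $\mathcal{X}$ with modulus $L_{g_k}$, and $\tilde g_k$ convex, Lipschitz continuous and separable (possibly non-smooth) on $\mathcal{X}$. Write $\mathbf{G}=[G_1,\dots,G_m]^{T}$ and $\mathbf{L}_{\mathbf{g}}=[L_{g_1},\dots,L_{g_m}]^{T}$. The program is $\min\{F(\mathbf{x}):\mathbf{x}\in\mathcal{X},\,G_k(\mathbf{x})\le0\ \forall k\}$. Standing assumptions: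 (i) an optimal solution $\mathbf{x}^\ast\in\mathcal{X}$ of the program exists (possibly non-unique); (ii) there is $\beta>0$ with $\Vert\mathbf{G}(\mathbf{x})-\mathbf{G}(\mathbf{y})\Vert\le\beta\Vert\mathbf{x}-\mathbf{y}\Vert$ for all $\mathbf{x},\mathbf{y}\in\mathcal{X}$; (iii) there is a vector $\boldsymbol{\lambda}^\ast\ge\mathbf{0}$ in $\mathbb{R}^m$ attaining strong duality, i.e. $q(\boldsymbol{\lambda}^\ast)=\min\{F(\mathbf{x}):\mathbf{x}\in\mathcal{X},\,G_k(\mathbf{x})\le0\ \forall k\}$, where $q(\boldsymbol{\lambda})=\min_{\mathbf{x}\in\mathcal{X}}\{F(\mathbf{x})+\sum_{k=1}^m\lambda_kG_k(\mathbf{x})\}$; (iv) there is $C>0$ with $\Vert\mathbf{G}(\mathbf{x})\Vert\le C$ for all $\mathbf{x}\in\mathcal{X}$, and there is $R>0$ with $\Vert\mathbf{x}-\mathbf{y}\Vert\le R$ for all $\mathbf{x},\mathbf{y}\in\mathcal{X}$. Algorithm with positive parameters $\{\alpha(t)\}_{t\ge0}$: choose any $\mathbf{x}(-1)\in\mathcal{X}$ and set $Q_k(0)=\max\{0,-G_k(\mathbf{x}(-1))\}$ for all $k$; $\mathbf{Q}(t)=[Q_1(t),\dots,Q_m(t)]^{T}$. At each iteration $t\in\{0,1,2,\dots\}$: (a) let $\mathbf{x}(t)$ be a minimizer over $\mathbf{x}\in\mathcal{X}$ of $$[\nabla f(\mathbf{x}(t-1))]^{T}\mathbf{x}+\tilde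 f(\mathbf{x})+\sum_{k=1}^m[Q_k(t)+G_k(\mathbf{x}(t-1))]\big[[\nabla g_k(\mathbf{x}(t-1))]^{T}\mathbf{x}+\tilde g_k(\mathbf{x})\big]+\alpha(t)\Vert\mathbf{x}-\mathbf{x}(t-1)\Vert^2;$$ (b) set $Q_k(t+1)=\max\{-G_k(\mathbf{x}(t)),\,Q_k(t)+G_k(\mathbf{x}(t))\}$ for all $k$; (c) set $\overline{\mathbf{x}}(t+1)=\frac1{t+1}\sum_{\tau=0}^{t}\mathbf{x}(\tau)$. *)

theory Defs
  imports "HOL-Analysis.Analysis"
begin

text \<open>\<open>P\<close> is a partition of the coordinates into blocks; \<open>h B\<close> is a function of the
  coordinates in block \<open>B\<close> only, encoded as a function on the whole space.\<close>

definition separable_on ::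
    "'n set set \<Rightarrow> (real ^ 'n) set \<Rightarrow> (real ^ 'n \<Rightarrow> real) \<Rightarrow> bool" where
  "separable_on P X \<phi> \<longleftrightarrow>
     partition_on UNIV P \<and>
     (\<exists>h. (\<forall>B\<in>P. \<forall>x y. (\<forall>i\<in>B. x $ i = y $ i) \<longrightarrow> h B x = h B y) \<and>
          (\<forall>x\<in>X. \<phi> x = (\<Sum>B\<in>P. h B x)))"

text \<open>Derivatives are taken within \<open>X\<close>, so \<open>\<phi>\<close> need not be differentiable off \<open>X\<close>. If \<open>X\<close> has
  empty interior the gradient is not unique; hence the gradient field \<open>D\<close> is an argument.
  The Lipschitz condition contains \<open>L \<ge> 0\<close> and the continuity of \<open>D\<close> on \<open>X\<close>.\<close>

definition smooth_with_gradient ::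
    "real \<Rightarrow> 'a::real_inner set \<Rightarrow> ('a \<Rightarrow> real) \<Rightarrow> ('a \<Rightarrow> 'a) \<Rightarrow> bool" where
  "smooth_with_gradient L X \<phi> D \<longleftrightarrow>
     (\<forall>x\<in>X. (\<phi> has_derivative (\<lambda>h. D x \<bullet> h)) (at x within X)) \<and> L-lipschitz_on X D"

definition lipschitz_continuous_on ::
    "'a::metric_space set \<Rightarrow> ('a \<Rightarrow> 'b::metric_space) \<Rightarrow> bool" where
  "lipschitz_continuous_on X \<phi> \<longleftrightarrow> (\<exists>K. K-lipschitz_on X \<phi>)"

definition feasible :: "'a set \<Rightarrow> ('a \<Rightarrow> real ^ 'm) \<Rightarrow> 'a set" where
  "feasible X G = {x \<in> X. \<forall>k. G x $ k \<le> 0}"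

definition is_min_value :: "('a \<Rightarrow> real) \<Rightarrow> 'a set \<Rightarrow> real \<Rightarrow> bool" where
  "is_min_value \<phi> S v \<longleftrightarrow> (\<exists>x. is_arg_min \<phi> (\<lambda>x. x \<in> S) x \<and> \<phi> x = v)"

text \<open>The dual function is a relation between \<open>lam\<close> and its value, since the minimum need not
  exist for every \<open>lam\<close>.\<close>

definition is_dual_value ::
    "'a set \<Rightarrow> ('a \<Rightarrow> real) \<Rightarrow> ('a \<Rightarrow> real ^ 'm) \<Rightarrow> real ^ 'm \<Rightarrow> real \<Rightarrow> bool" where
  "is_dual_value X F G lam v \<longleftrightarrow> is_min_value (\<lambda>x. F x + (\<Sum>k\<in>UNIV. lam $ k * G x $ k)) X v"

definition attains_strong_duality ::
    "'a set \<Rightarrow> ('a \<Rightarrow> real) \<Rightarrow> ('a \<Rightarrow> real ^ 'm) \<Rightarrow> real ^ 'm \<Rightarrow> bool" where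
  "attains_strong_duality X F G lam \<longleftrightarrow>
     (\<forall>k. 0 \<le> lam $ k) \<and>
     (\<exists>v. is_dual_value X F G lam v \<and> is_min_value F (feasible X G) v)"

definition step_objective ::
    "(real ^ 'n \<Rightarrow> real ^ 'n) \<Rightarrow> (real ^ 'n \<Rightarrow> real) \<Rightarrow> ('m \<Rightarrow> real ^ 'n \<Rightarrow> real ^ 'n) \<Rightarrow>
     ('m \<Rightarrow> real ^ 'n \<Rightarrow> real) \<Rightarrow> (real ^ 'n \<Rightarrow> real ^ 'm) \<Rightarrow>
     real ^ 'm \<Rightarrow> real \<Rightarrow> real ^ 'n \<Rightarrow> real ^ 'n \<Rightarrow> real" where
  "step_objective Df ft Dg gt G q a y x =
     Df y \<bullet> x + ft x + (\<Sum>k\<in>UNIV. (q $ k + G y $ k) * (Dg k y \<bullet> x + gt k x))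
     + a * (norm (x - y))\<^sup>2"

text \<open>The iterate preceding \<open>x t\<close>, where \<open>x_init\<close> stands for \<open>x(-1)\<close>.\<close>

definition prev :: "'a \<Rightarrow> (nat \<Rightarrow> 'a) \<Rightarrow> nat \<Rightarrow> 'a" where
  "prev x_init x t = (case t of 0 \<Rightarrow> x_init | Suc s \<Rightarrow> x s)"

text \<open>The minimizers need not be unique, so the algorithm is a predicate on its runs.
  The value \<open>xbar 0\<close> is unconstrained.\<close>

definition algorithm_run ::
    "(real ^ 'n) set \<Rightarrow> (real ^ 'n \<Rightarrow> real ^ 'n) \<Rightarrow> (real ^ 'n \<Rightarrow> real) \<Rightarrow>
     ('m \<Rightarrow> real ^ 'n \<Rightarrow> real ^ 'n) \<Rightarrow> ('m \<Rightarrow> real ^ 'n \<Rightarrow> real) \<Rightarrow>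
     (real ^ 'n \<Rightarrow> real ^ 'm) \<Rightarrow> (nat \<Rightarrow> real) \<Rightarrow> real ^ 'n \<Rightarrow> (nat \<Rightarrow> real ^ 'n) \<Rightarrow>
     (nat \<Rightarrow> real ^ 'm) \<Rightarrow> (nat \<Rightarrow> real ^ 'n) \<Rightarrow> bool" where
  "algorithm_run X Df ft Dg gt G \<alpha> x_init x Q xbar \<longleftrightarrow>
     (\<forall>t. 0 < \<alpha> t) \<and>
     x_init \<in> X \<and>
     (\<forall>k. Q 0 $ k = max 0 (- G x_init $ k)) \<and>
     (\<forall>t. is_arg_min (step_objective Df ft Dg gt G (Q t) (\<alpha> t) (prev x_init x t))
            (\<lambda>y. y \<in> X) (x t)) \<and>
     (\<forall>t k. Q (Suc t) $ k = max (- G (x t) $ k) (Q t $ k + G (x t) $ k)) \<and>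
     (\<forall>t. xbar (Suc t) = (1 / real (Suc t)) *\<^sub>R (\<Sum>\<tau>=0..t. x \<tau>))"

end

theory Submission
  imports Defs
begin

text \<open>
  The argument is a drift-plus-penalty analysis. Write \<open>p 0 = x(-1)\<close> and \<open>p (t + 1) = x(t)\<close>. The
  function minimized in a step is convex plus \<open>\<alpha>(t)\<close> times a squared distance, so its minimizer
  beats any other point \<open>z\<close> by a margin quadratic in the distance to \<open>z\<close>
  (\<open>proximal_three_point\<close>). Convexity turns the linearizations at \<open>z\<close> into lower bounds, smoothness
  turns those at \<open>x(t)\<close> into upper bounds with a quadratic error, and \<open>\<alpha>(t)\<close> is chosen to absorb
  that error with \<open>\<beta>\<^sup>2 / 2\<close> to spare (\<open>step_descent\<close>). The weights
  \<open>Q(t) + G(x(t-1))\<close> are nonnegative, which is what the unusual queue update is designed for, so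
  convexity of the constraint functions points in the useful direction.

  With \<open>z = x*\<close>, the spare \<open>\<beta>\<^sup>2 / 2\<close> pays for replacing \<open>G(x(t-1)) \<bullet> G(x(t))\<close> by half the sum of the
  squared norms. Together with the bound on the change of \<open>\<parallel>Q\<parallel>\<^sup>2 / 2\<close>
  (\<open>virtual_queue_drift\<close>), every term of the resulting inequality telescopes except the objective:
  the squared distances to \<open>x*\<close> because \<open>\<alpha>\<close> is nondecreasing and the set has diameter at most \<open>R\<close>
  (\<open>weighted_telescope_le\<close>). Hence the accumulated objective plus \<open>\<parallel>Q(t)\<parallel>\<^sup>2 / 2\<close> is at most
  \<open>t F(x*) + \<alpha>(t-1) R\<^sup>2 + \<parallel>G(x(t-1))\<parallel>\<^sup>2 / 2\<close>. The last term is dominated by the queue term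
  (\<open>virtual_queue_dominates\<close>), and Jensen's inequality gives the objective bound.

  For the constraints, the queue dominates the accumulated constraint values
  (\<open>virtual_queue_sum_le\<close>), so it suffices to bound \<open>\<parallel>Q(t)\<parallel>\<close>. Strong duality bounds the accumulated
  objective from below by \<open>t F(x*) - \<parallel>\<lambda>*\<parallel> \<parallel>Q(t)\<parallel>\<close>, which leaves a quadratic inequality for
  \<open>\<parallel>Q(t)\<parallel>\<close> (\<open>quadratic_inequality_bound\<close>). The resulting bound on \<open>\<parallel>Q(t)\<parallel>\<close> involves \<open>\<alpha>(t-1)\<close>, while
  \<open>\<alpha>(t)\<close> is defined from \<open>Q(t)\<close>. The circle closes by induction on \<open>t\<close>: the constant \<open>\<alpha>max\<close> is such
  that the bound \<open>\<alpha>max\<close> on the parameters reproduces itself (\<open>step_bound_invariant\<close>).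
\<close>

section \<open>First-order bounds for functions differentiable within a convex set\<close>

text \<open>The derivative at a boundary point of \<open>X\<close> only sees directions into \<open>X\<close>. That is enough
  for both bounds below, which are read off the restriction to a segment.\<close>

lemma has_derivative_along_segment:
  fixes \<phi> :: "'a::real_inner \<Rightarrow> real"
  assumes "convex X" "y \<in> X" "z \<in> X" "s \<in> {0..1}"
    and "\<And>x. x \<in> X \<Longrightarrow> (\<phi> has_derivative (\<lambda>h. D x \<bullet> h)) (at x within X)"
  shows "((\<lambda>s. \<phi> (y + s *\<^sub>R (z - y))) has_derivative
           (\<lambda>h. h * (D (y + s *\<^sub>R (z - y)) \<bullet> (z - y)))) (at s within {0..1})"
proof -
  have mem: "y + r *\<^sub>R (z - y) \<in> X" if "r \<in> {0..1}" for r
  proof -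
    have "(1 - r) *\<^sub>R y + r *\<^sub>R z \<in> X"
      using that assms(1-3) by (intro convexD) auto
    then show ?thesis by (simp add: algebra_simps)
  qed
  have "((\<lambda>s. y + s *\<^sub>R (z - y)) has_derivative (\<lambda>h. h *\<^sub>R (z - y))) (at s within {0..1})"
    using has_derivative_add[OF has_derivative_const has_derivative_scaleR_left[OF has_derivative_ident]]
    by simp
  then have "((\<lambda>s. \<phi> (y + s *\<^sub>R (z - y))) has_derivative
      (\<lambda>h. D (y + s *\<^sub>R (z - y)) \<bullet> (h *\<^sub>R (z - y)))) (at s within {0..1})"
    using mem
    by (intro has_derivative_in_compose2[where t = X and g' = "\<lambda>x h. D x \<bullet> h", OF assms(5) _ assms(4)])
      blast+
  then show ?thesis by (simp only: inner_scaleR_right)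
qed

text \<open>Subtracting the claimed upper model along the segment leaves a function whose derivative is
  nonpositive, because at parameter \<open>s\<close> the gradient has moved by at most \<open>L * s * norm (z - y)\<close>.\<close>

lemma smooth_upper_bound:
  fixes \<phi> :: "'a::real_inner \<Rightarrow> real"
  assumes "convex X" "smooth_with_gradient L X \<phi> D" "y \<in> X" "z \<in> X"
  shows "\<phi> z \<le> \<phi> y + D y \<bullet> (z - y) + L / 2 * (norm (z - y))\<^sup>2"
proof -
  have der: "\<And>x. x \<in> X \<Longrightarrow> (\<phi> has_derivative (\<lambda>h. D x \<bullet> h)) (at x within X)"
    and lip: "L-lipschitz_on X D"
    using assms(2) by (auto simp: smooth_with_gradient_def)
  define p where "p s = y + s *\<^sub>R (z - y)" for s
  define c where "c = D y \<bullet> (z - y)"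
  define n where "n = (norm (z - y))\<^sup>2"
  define \<psi> where "\<psi> s = \<phi> (p s) - (s * c + L / 2 * s\<^sup>2 * n)" for s
  have "(\<psi> has_derivative (\<lambda>h. h * (D (p s) \<bullet> (z - y)) - h * (c + L * s * n))) (at s within {0..1})"
    if "s \<in> {0..1}" for s
  proof -
    have "((\<lambda>s. s * c + L / 2 * s\<^sup>2 * n) has_derivative (\<lambda>h. h * (c + L * s * n)))
        (at s within {0..1})"
      by (auto intro!: derivative_eq_intros simp: algebra_simps)
    then show ?thesis
      unfolding \<psi>_def p_def
      using has_derivative_along_segment[OF assms(1,3,4) that der] by (intro has_derivative_diff)
  qed
  then obtain s where s: "s \<in> {0<..<1}" and
    mvt: "\<psi> 1 - \<psi> 0 = D (p s) \<bullet> (z - y) - (c + L * s * n)"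
    using mvt_simple[of 0 1 \<psi> "\<lambda>s h. h * (D (p s) \<bullet> (z - y)) - h * (c + L * s * n)"] by auto
  have ps: "p s \<in> X"
  proof -
    have "(1 - s) *\<^sub>R y + s *\<^sub>R z \<in> X" using s assms by (intro convexD) auto
    then show ?thesis by (simp add: p_def algebra_simps)
  qed
  have "D (p s) \<bullet> (z - y) - c \<le> norm (D (p s) - D y) * norm (z - y)"
    by (simp add: c_def norm_cauchy_schwarz flip: inner_diff_left)
  also have "\<dots> \<le> (L * norm (p s - y)) * norm (z - y)"
    using lipschitz_onD[OF lip ps assms(3)]
    by (intro mult_right_mono) (auto simp: dist_norm)
  also have "\<dots> = L * s * n"
    using s by (simp add: p_def n_def power2_eq_square)
  finally have "\<psi> 1 \<le> \<psi> 0" using mvt by linarith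
  moreover have "\<psi> 0 = \<phi> y" "\<psi> 1 = \<phi> z - (c + L / 2 * n)" by (simp_all add: \<psi>_def p_def)
  ultimately show ?thesis unfolding c_def n_def by linarith
qed

text \<open>The difference quotients from \<open>y\<close> towards \<open>z\<close> never exceed \<open>\<phi> z - \<phi> y\<close>, and they converge to
  the directional derivative.\<close>

lemma convex_above_linearization:
  fixes \<phi> :: "'a::real_inner \<Rightarrow> real"
  assumes "convex_on X \<phi>" "smooth_with_gradient L X \<phi> D" "y \<in> X" "z \<in> X"
  shows "\<phi> y + D y \<bullet> (z - y) \<le> \<phi> z"
proof -
  have X: "convex X" using assms(1) by (rule convex_on_imp_convex)
  have der: "\<And>x. x \<in> X \<Longrightarrow> (\<phi> has_derivative (\<lambda>h. D x \<bullet> h)) (at x within X)"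
    using assms(2) by (auto simp: smooth_with_gradient_def)
  define p where "p s = \<phi> (y + s *\<^sub>R (z - y))" for s
  have "(p has_field_derivative D y \<bullet> (z - y)) (at 0 within {0..1})"
    using has_derivative_along_segment[OF X assms(3,4) _ der, of 0]
    by (simp add: p_def[abs_def] has_field_derivative_def mult_commute_abs)
  then have lim: "((\<lambda>s. (p s - p 0) / s) \<longlongrightarrow> D y \<bullet> (z - y)) (at 0 within {0..1})"
    by (simp add: has_field_derivative_iff)
  have "(p s - p 0) / s \<le> \<phi> z - \<phi> y" if "s \<in> {0..1}" "s \<noteq> 0" for s
  proof -
    have "\<phi> ((1 - s) *\<^sub>R y + s *\<^sub>R z) \<le> (1 - s) * \<phi> y + s * \<phi> z"
      using that assms by (intro convex_onD) auto
    then have "p s - p 0 \<le> s * (\<phi> z - \<phi> y)" by (simp add: p_def algebra_simps)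
    then show ?thesis using that by (simp add: divide_le_eq mult.commute)
  qed
  then have "\<forall>\<^sub>F s in at 0 within {0..1}. (p s - p 0) / s \<le> \<phi> z - \<phi> y"
    by (auto simp: eventually_at_filter)
  moreover have "at (0::real) within {0..1} \<noteq> bot"
    by (simp add: trivial_limit_within islimpt_Icc)
  ultimately have "D y \<bullet> (z - y) \<le> \<phi> z - \<phi> y"
    using tendsto_upperbound[OF lim] by blast
  then show ?thesis by simp
qed

section \<open>One proximal step\<close>

lemma power2_norm_add_scaleR:
  fixes v w :: "'a::real_inner"
  shows "(norm (v + s *\<^sub>R w))\<^sup>2 = (norm v)\<^sup>2 + 2 * s * (v \<bullet> w) + s\<^sup>2 * (norm w)\<^sup>2"
proof -
  have "(v + s *\<^sub>R w) \<bullet> (v + s *\<^sub>R w) = v \<bullet> v + 2 * s * (v \<bullet> w) + s\<^sup>2 * (w \<bullet> w)"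
    unfolding inner_add_left inner_add_right inner_scaleR_left inner_scaleR_right
      inner_commute[of w v] power2_eq_square
    by (simp only: distrib_left mult.assoc)
  then show ?thesis by (simp only: power2_norm_eq_inner)
qed

text \<open>Comparing the minimizer \<open>u\<close> with points on the segment to \<open>z\<close> and letting them tend to \<open>u\<close> gives
  the first-order condition \<open>0 \<le> c z - c u + 2 * a * ((u - y) \<bullet> (z - u))\<close> although \<open>c\<close> may fail to be
  differentiable. The law of cosines then rewrites the inner product.\<close>

lemma proximal_three_point:
  fixes c :: "'a::real_inner \<Rightarrow> real"
  assumes "convex_on X c" "is_arg_min (\<lambda>x. c x + a * (norm (x - y))\<^sup>2) (\<lambda>x. x \<in> X) u" "z \<in> X"
  shows "c u + a * (norm (u - y))\<^sup>2 + a * (norm (z - u))\<^sup>2 \<le> c z + a * (norm (z - y))\<^sup>2"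
proof -
  have u: "u \<in> X" and
    min: "\<And>x. x \<in> X \<Longrightarrow> c u + a * (norm (u - y))\<^sup>2 \<le> c x + a * (norm (x - y))\<^sup>2"
    using assms(2) by (auto simp: is_arg_min_linorder)
  have "0 \<le> c z - c u + 2 * a * ((u - y) \<bullet> (z - u)) + s * (a * (norm (z - u))\<^sup>2)"
    if s: "s \<in> {0<..<1}" for s
  proof -
    define v where "v = (1 - s) *\<^sub>R u + s *\<^sub>R z"
    have "v \<in> X" unfolding v_def
      using s u assms(3) convex_on_imp_convex[OF assms(1)] by (intro convexD) auto
    then have 1: "c u + a * (norm (u - y))\<^sup>2 \<le> c v + a * (norm (v - y))\<^sup>2" by (rule min)
    have 2: "c v \<le> (1 - s) * c u + s * c z"
      unfolding v_def using s u assms by (intro convex_onD) auto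
    have "v - y = (u - y) + s *\<^sub>R (z - u)" by (simp add: v_def algebra_simps)
    then have 3: "(norm (v - y))\<^sup>2 =
        (norm (u - y))\<^sup>2 + 2 * s * ((u - y) \<bullet> (z - u)) + s\<^sup>2 * (norm (z - u))\<^sup>2"
      by (simp only: power2_norm_add_scaleR)
    have "0 \<le> s * (c z - c u + 2 * a * ((u - y) \<bullet> (z - u)) + s * (a * (norm (z - u))\<^sup>2))"
      using 1 2 unfolding 3 by (simp add: algebra_simps power2_eq_square)
    then show ?thesis using s by (simp add: zero_le_mult_iff)
  qed
  then have "\<forall>\<^sub>F s in at_right 0.
      0 \<le> c z - c u + 2 * a * ((u - y) \<bullet> (z - u)) + s * (a * (norm (z - u))\<^sup>2)"
    using eventually_at_right_real[of 0 1] by (auto elim!: eventually_mono)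
  moreover have "((\<lambda>s. c z - c u + 2 * a * ((u - y) \<bullet> (z - u)) + s * (a * (norm (z - u))\<^sup>2))
      \<longlongrightarrow> c z - c u + 2 * a * ((u - y) \<bullet> (z - u)) + 0 * (a * (norm (z - u))\<^sup>2)) (at_right 0)"
    by (intro tendsto_intros)
  ultimately have "0 \<le> c z - c u + 2 * a * ((u - y) \<bullet> (z - u))"
    using tendsto_lowerbound[of _ _ "at_right (0::real)"] by force
  then have "a * 0 \<le> c z - c u + a * (2 * ((u - y) \<bullet> (z - u)))" by simp
  moreover have "2 * ((u - y) \<bullet> (z - u)) = (norm (z - y))\<^sup>2 - (norm (u - y))\<^sup>2 - (norm (z - u))\<^sup>2"
    using power2_norm_add_scaleR[of "u - y" 1 "z - u"] by simp
  ultimately show ?thesis by (simp only: right_diff_distrib)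
qed

lemma convex_on_inner: "convex X \<Longrightarrow> convex_on X (\<lambda>x. a \<bullet> x)"
  by (simp add: convex_on_def inner_add_right)

lemma convex_on_weighted_sum:
  assumes "convex X" "\<And>k. k \<in> I \<Longrightarrow> convex_on X (h k)" "\<And>k. k \<in> I \<Longrightarrow> 0 \<le> (w k :: real)"
  shows "convex_on X (\<lambda>x. \<Sum>k\<in>I. w k * h k x)"
  using assms(2,3)
proof (induction I rule: infinite_finite_induct)
  case (insert k I)
  then show ?case by (auto intro!: convex_on_add convex_on_cmul)
qed (use assms(1) in \<open>auto simp: convex_on_const\<close>)

text \<open>Adding the constant \<open>e\<close> of the proof completes the inner products in the step objective to
  linearizations at \<open>y\<close>, which lie below the true functions at \<open>z\<close> and, up to \<open>(Lf + (q + G y) \<bullet> Lg) / 2\<close> times a squared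
  distance, above them at \<open>u\<close>. The surplus \<open>b\<close> is left free; it later compensates the variation
  of \<open>G\<close> between consecutive iterates.\<close>

lemma step_descent:
  fixes G :: "real ^ 'n \<Rightarrow> real ^ 'm::finite" and Lg q :: "real ^ 'm"
  assumes f: "convex_on X f" "smooth_with_gradient Lf X f Df" "convex_on X ft"
    and g: "\<And>k. convex_on X (g k)" "\<And>k. smooth_with_gradient (Lg $ k) X (g k) (Dg k)"
      "\<And>k. convex_on X (gt k)"
    and G: "\<And>x k. G x $ k = g k x + gt k x"
    and w: "\<And>k. 0 \<le> q $ k + G y $ k"
    and a: "1/2 * (b + Lf + (q + G y) \<bullet> Lg) \<le> a"
    and u: "is_arg_min (step_objective Df ft Dg gt G q a y) (\<lambda>x. x \<in> X) u"
    and "y \<in> X" "z \<in> X"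
  shows "f u + ft u + (q + G y) \<bullet> G u + b / 2 * (norm (u - y))\<^sup>2
    \<le> f z + ft z + (q + G y) \<bullet> G z + a * ((norm (z - y))\<^sup>2 - (norm (z - u))\<^sup>2)"
proof -
  define w where "w = q + G y"
  have w0: "0 \<le> w $ k" for k using w by (simp add: w_def)
  have X: "convex X" using f(1) by (rule convex_on_imp_convex)
  define c where "c x = Df y \<bullet> x + ft x + (\<Sum>k\<in>UNIV. w $ k * (Dg k y \<bullet> x + gt k x))" for x
  have obj: "step_objective Df ft Dg gt G q a y = (\<lambda>x. c x + a * (norm (x - y))\<^sup>2)"
    by (auto simp: step_objective_def c_def w_def)
  have "convex_on X c"
    unfolding c_def[abs_def] using X f g w0
    by (intro convex_on_add convex_on_inner convex_on_weighted_sum) auto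
  then have opt: "c u + a * (norm (u - y))\<^sup>2 + a * (norm (z - u))\<^sup>2 \<le> c z + a * (norm (z - y))\<^sup>2"
    using u \<open>z \<in> X\<close> unfolding obj by (rule proximal_three_point)
  have "u \<in> X" using u by (simp add: is_arg_min_def)
  define e where "e = f y - Df y \<bullet> y + (\<Sum>k\<in>UNIV. w $ k * (g k y - Dg k y \<bullet> y))"
  have wG: "w \<bullet> G x = (\<Sum>k\<in>UNIV. w $ k * g k x) + (\<Sum>k\<in>UNIV. w $ k * gt k x)" for x
    by (simp add: inner_vec_def G algebra_simps sum.distrib)
  have upper: "c z + e \<le> f z + ft z + w \<bullet> G z"
  proof -
    have "f y + Df y \<bullet> (z - y) \<le> f z"
      using f \<open>y \<in> X\<close> \<open>z \<in> X\<close> convex_above_linearization by blast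
    moreover have "(\<Sum>k\<in>UNIV. w $ k * (g k y + Dg k y \<bullet> (z - y))) \<le> (\<Sum>k\<in>UNIV. w $ k * g k z)"
      using g \<open>y \<in> X\<close> \<open>z \<in> X\<close> w0
      by (intro sum_mono mult_left_mono convex_above_linearization) auto
    ultimately show ?thesis
      by (simp add: c_def e_def wG algebra_simps sum.distrib sum_subtractf)
  qed
  have lower: "f u + ft u + w \<bullet> G u \<le> c u + e + (Lf + w \<bullet> Lg) / 2 * (norm (u - y))\<^sup>2"
  proof -
    have "f u \<le> f y + Df y \<bullet> (u - y) + Lf / 2 * (norm (u - y))\<^sup>2"
      using X f \<open>y \<in> X\<close> \<open>u \<in> X\<close> smooth_upper_bound by blast
    moreover have "(\<Sum>k\<in>UNIV. w $ k * g k u) \<le>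
        (\<Sum>k\<in>UNIV. w $ k * (g k y + Dg k y \<bullet> (u - y) + Lg $ k / 2 * (norm (u - y))\<^sup>2))"
      using X g \<open>y \<in> X\<close> \<open>u \<in> X\<close> w0
      by (intro sum_mono mult_left_mono smooth_upper_bound) auto
    moreover have "(\<Sum>k\<in>UNIV. w $ k * (g k y + Dg k y \<bullet> (u - y) + Lg $ k / 2 * (norm (u - y))\<^sup>2))
        = (\<Sum>k\<in>UNIV. w $ k * (g k y - Dg k y \<bullet> y)) + (\<Sum>k\<in>UNIV. w $ k * (Dg k y \<bullet> u))
          + w \<bullet> Lg / 2 * (norm (u - y))\<^sup>2"
      unfolding inner_vec_def[of w Lg] sum_divide_distrib sum_distrib_right sum.distrib[symmetric]
      by (intro sum.cong) (auto simp: algebra_simps)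
    moreover have "c u = Df y \<bullet> u + ft u + (\<Sum>k\<in>UNIV. w $ k * (Dg k y \<bullet> u)) + (\<Sum>k\<in>UNIV. w $ k * gt k u)"
      by (simp add: c_def distrib_left sum.distrib)
    ultimately show ?thesis
      unfolding e_def wG inner_diff_right add_divide_distrib distrib_right by linarith
  qed
  have "(b + (Lf + w \<bullet> Lg)) / 2 * (norm (u - y))\<^sup>2 \<le> a * (norm (u - y))\<^sup>2"
    using a by (intro mult_right_mono) (auto simp: w_def)
  then show ?thesis
    using opt upper lower unfolding w_def[symmetric]
    by (simp add: algebra_simps add_divide_distrib)
qed

section \<open>Virtual queues\<close>

text \<open>The sequence \<open>c\<close> of constraint values is shifted by one against the iterates: \<open>c 0\<close> belongs to the
  initial point and \<open>c (Suc t)\<close> to the iterate \<open>x t\<close>.\<close>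

definition virtual_queue :: "(nat \<Rightarrow> real ^ 'm) \<Rightarrow> (nat \<Rightarrow> real ^ 'm) \<Rightarrow> bool" where
  "virtual_queue c Q \<longleftrightarrow>
     (\<forall>k. Q 0 $ k = max 0 (- c 0 $ k)) \<and>
     (\<forall>t k. Q (Suc t) $ k = max (- c (Suc t) $ k) (Q t $ k + c (Suc t) $ k))"

text \<open>The first entry of the maximum in the queue update is there for the second inequality: the
  weights of the constraint functions in the step objective must not be negative.\<close>

lemma virtual_queue_nonneg_compensated:
  assumes "virtual_queue c Q"
  shows "0 \<le> Q t $ k \<and> 0 \<le> Q t $ k + c t $ k"
  using assms by (induction t) (auto simp: virtual_queue_def max_def)

lemma virtual_queue_initial_norm:
  fixes c :: "nat \<Rightarrow> real ^ 'm::finite"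
  assumes "virtual_queue c Q"
  shows "norm (Q 0) \<le> norm (c 0)"
  using assms by (intro norm_le_componentwise_cart) (auto simp: virtual_queue_def)

text \<open>Either sign of \<open>c\<close> is caught by one entry of the maximum: the first one if \<open>c\<close> is negative, and
  otherwise the second one, as the previous queue value is nonnegative.\<close>

lemma virtual_queue_dominates:
  fixes c :: "nat \<Rightarrow> real ^ 'm::finite"
  assumes "virtual_queue c Q"
  shows "norm (c (Suc t)) \<le> norm (Q (Suc t))"
proof (intro norm_le_componentwise_cart)
  fix k
  have "Q (Suc t) $ k = max (- c (Suc t) $ k) (Q t $ k + c (Suc t) $ k)" "0 \<le> Q t $ k"
    using assms virtual_queue_nonneg_compensated[OF assms] by (auto simp: virtual_queue_def)
  then show "norm (c (Suc t) $ k) \<le> norm (Q (Suc t) $ k)" by (auto simp: max_def)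
qed

text \<open>This is how a bound on the queue becomes a bound on the accumulated constraint violation.\<close>

lemma virtual_queue_sum_le:
  assumes "virtual_queue c Q"
  shows "(\<Sum>\<tau><t. c (Suc \<tau>) $ k) \<le> Q t $ k"
proof (induction t)
  case 0
  show ?case using virtual_queue_nonneg_compensated[OF assms] by simp
next
  case (Suc t)
  have "Q t $ k + c (Suc t) $ k \<le> Q (Suc t) $ k" using assms by (simp add: virtual_queue_def)
  then show ?case using Suc.IH by simp
qed

text \<open>If the second entry of the maximum is taken in a coordinate, expanding the square needs only
  half of the quadratic term. If the first is taken, the two sides differ by
  \<open>(Q t $ k + c (Suc t) $ k)\<^sup>2 / 2\<close>.\<close>

lemma virtual_queue_drift:
  fixes c :: "nat \<Rightarrow> real ^ 'm::finite"
  assumes "virtual_queue c Q"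
  shows "(norm (Q (Suc t)))\<^sup>2 / 2 - (norm (Q t))\<^sup>2 / 2 \<le> Q t \<bullet> c (Suc t) + (norm (c (Suc t)))\<^sup>2"
proof -
  have "(Q (Suc t) $ k)\<^sup>2 - (Q t $ k)\<^sup>2 \<le> 2 * (Q t $ k * c (Suc t) $ k) + 2 * (c (Suc t) $ k)\<^sup>2" for k
  proof -
    have "max (- d) (r + d) ^ 2 - r\<^sup>2 \<le> 2 * (r * d) + 2 * d\<^sup>2" for r d :: real
      using zero_le_power2[of "r + d"] zero_le_power2[of d]
      by (auto simp: max_def power2_eq_square algebra_simps)
    then show ?thesis using assms by (simp add: virtual_queue_def)
  qed
  then have "(\<Sum>k\<in>UNIV. (Q (Suc t) $ k)\<^sup>2 - (Q t $ k)\<^sup>2)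
      \<le> (\<Sum>k\<in>UNIV. 2 * (Q t $ k * c (Suc t) $ k) + 2 * (c (Suc t) $ k)\<^sup>2)"
    by (rule sum_mono)
  then show ?thesis
    unfolding power2_norm_eq_inner
    by (simp add: inner_vec_def sum.distrib sum_subtractf power2_eq_square
        flip: sum_distrib_left)
qed

section \<open>Real inequalities for the summation and for the step parameters\<close>

text \<open>Summation by parts: each increase of the weight \<open>a\<close> meets a distance of at most \<open>D\<close>, so the total
  is what it would be with the largest weight throughout and the largest distance at the start.\<close>

lemma weighted_telescope_le:
  fixes a d :: "nat \<Rightarrow> real"
  assumes "\<And>t. a t \<le> a (Suc t)" "0 \<le> a 0" "\<And>t. 0 \<le> d t" "\<And>t. d t \<le> D"
  shows "(\<Sum>\<tau><Suc t. a \<tau> * (d \<tau> - d (Suc \<tau>))) \<le> a t * D"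
proof -
  have "(\<Sum>\<tau><Suc t. a \<tau> * (d \<tau> - d (Suc \<tau>))) \<le> a t * (D - d (Suc t))"
  proof (induction t)
    case 0
    have "a 0 * d 0 \<le> a 0 * D" using assms by (intro mult_left_mono) auto
    then show ?case by (simp add: algebra_simps)
  next
    case (Suc t)
    have "a t * (D - d (Suc t)) \<le> a (Suc t) * (D - d (Suc t))"
      using assms by (intro mult_right_mono) auto
    then show ?case using Suc.IH by (simp add: algebra_simps)
  qed
  moreover have "0 \<le> a t" using assms(1,2) by (induction t) (auto intro: order_trans)
  ultimately show ?thesis using assms(3)[of "Suc t"]
    by (smt (verit) mult_left_mono)
qed

text \<open>Completing the square gives \<open>q \<le> l + sqrt (l\<^sup>2 + 2 * a * r\<^sup>2 + C\<^sup>2)\<close>, and the root of a sum of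
  squares is at most the sum of the terms.\<close>

lemma quadratic_inequality_bound:
  fixes q l r a C :: real
  assumes "q\<^sup>2 / 2 \<le> l * q + a * r\<^sup>2 + C\<^sup>2 / 2" "0 \<le> l" "0 \<le> r" "0 \<le> a" "0 \<le> C"
  shows "q \<le> 2 * l + r * sqrt (2 * a) + C"
proof -
  define b where "b = r * sqrt (2 * a)"
  have b: "0 \<le> b" "b\<^sup>2 = 2 * a * r\<^sup>2" using assms by (auto simp: b_def power_mult_distrib)
  have "(q - l)\<^sup>2 \<le> l\<^sup>2 + b\<^sup>2 + C\<^sup>2"
    using assms(1) b(2) by (simp add: power2_eq_square algebra_simps)
  also have "\<dots> \<le> (l + b + C)\<^sup>2"
    using assms b(1) by (simp add: power2_eq_square algebra_simps)
  finally have "q - l \<le> l + b + C"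
    by (rule power2_le_imp_le) (use assms b in auto)
  then show ?thesis by (simp add: b_def)
qed

text \<open>The left side is the bound on the next step parameter that follows if the previous one is at most
  \<open>M\<close>. With \<open>b = sqrt 2 / 2 * r * l\<close> it is the map \<open>M \<mapsto> A + b * sqrt M\<close>, which sends
  \<open>(sqrt A + b)\<^sup>2\<close> to a value smaller than itself by \<open>b * sqrt A\<close>.\<close>

lemma step_bound_invariant:
  fixes A r l :: real
  assumes "0 \<le> A" "0 \<le> r" "0 \<le> l" and M: "M = (sqrt A + sqrt 2 / 2 * r * l)\<^sup>2"
  shows "A + r * sqrt (2 * M) / 2 * l \<le> M"
proof -
  define b where "b = sqrt 2 / 2 * r * l"
  have b: "0 \<le> b" using assms by (simp add: b_def)
  have "sqrt M = sqrt A + b" using assms b by (simp add: b_def)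
  then have "r * sqrt (2 * M) / 2 * l = b * (sqrt A + b)"
    by (simp add: b_def real_sqrt_mult)
  moreover have "M = A + 2 * (b * sqrt A) + b\<^sup>2"
    using assms(1) unfolding M b_def[symmetric] by (simp add: power2_sum)
  ultimately show ?thesis using assms b by (simp add: algebra_simps power2_eq_square)
qed

lemma convex_on_average:
  fixes p :: "nat \<Rightarrow> 'a::real_vector"
  assumes "convex_on X h" "\<And>\<tau>. p \<tau> \<in> X" "0 < t"
  shows "h ((1 / real t) *\<^sub>R (\<Sum>\<tau><t. p \<tau>)) \<le> (1 / real t) * (\<Sum>\<tau><t. h (p \<tau>))"
proof -
  have "h (\<Sum>\<tau><t. (1 / real t) *\<^sub>R p \<tau>) \<le> (\<Sum>\<tau><t. (1 / real t) * h (p \<tau>))"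
    using assms by (intro convex_on_sum) auto
  then show ?thesis by (simp add: scaleR_sum_right sum_distrib_left)
qed

section \<open>Convergence of the algorithm\<close>

theorem theorem2:
  fixes X :: "(real ^ 'n) set"
    and f ft F :: "real ^ 'n \<Rightarrow> real" and Df :: "real ^ 'n \<Rightarrow> real ^ 'n"
    and g gt :: "'m::finite \<Rightarrow> real ^ 'n \<Rightarrow> real" and Dg :: "'m \<Rightarrow> real ^ 'n \<Rightarrow> real ^ 'n"
    and G :: "real ^ 'n \<Rightarrow> real ^ 'm"
    and Pf :: "'n set set" and Pg :: "'m \<Rightarrow> 'n set set"
    and Lf \<beta> C R \<alpha>max :: real and Lg lam :: "real ^ 'm"
    and xstar x_init :: "real ^ 'n" and x xbar :: "nat \<Rightarrow> real ^ 'n"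
    and Q :: "nat \<Rightarrow> real ^ 'm" and \<alpha> :: "nat \<Rightarrow> real"
  assumes X: "closed X" "convex X"
    and f: "convex_on X f" "smooth_with_gradient Lf X f Df"
    and ft: "convex_on X ft" "separable_on Pf X ft"
    and g: "\<And>k. convex_on X (g k)" "\<And>k. lipschitz_continuous_on X (g k)"
      "\<And>k. smooth_with_gradient (Lg $ k) X (g k) (Dg k)"
    and gt: "\<And>k. convex_on X (gt k)" "\<And>k. lipschitz_continuous_on X (gt k)"
      "\<And>k. separable_on (Pg k) X (gt k)"
    and F: "\<And>x. F x = f x + ft x"
    and G: "\<And>x k. G x $ k = g k x + gt k x"
    and xstar: "is_arg_min F (\<lambda>x. x \<in> feasible X G) xstar"
    and \<beta>: "\<beta> > 0" "\<And>x y. x \<in> X \<Longrightarrow> y \<in> X \<Longrightarrow> norm (G x - G y) \<le> \<beta> * norm (x - y)"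
    and lam: "attains_strong_duality X F G lam"
    and C: "C > 0" "\<And>x. x \<in> X \<Longrightarrow> norm (G x) \<le> C"
    and R: "R > 0" "\<And>x y. x \<in> X \<Longrightarrow> y \<in> X \<Longrightarrow> norm (x - y) \<le> R"
    and run: "algorithm_run X Df ft Dg gt G \<alpha> x_init x Q xbar"
    and \<alpha>_0: "\<alpha> 0 = 1/2 * (\<beta>\<^sup>2 + Lf + (Q 0 + G x_init) \<bullet> Lg)"
    and \<alpha>_step: "\<And>t. t \<ge> 1 \<Longrightarrow>
      \<alpha> t = max (\<alpha> (t - 1)) (1/2 * (\<beta>\<^sup>2 + Lf + (Q t + G (x (t - 1))) \<bullet> Lg))"
    and \<alpha>max: "\<alpha>max = (sqrt (1/2 * \<beta>\<^sup>2 + 1/2 * Lf + norm lam * norm Lg + C * norm Lg)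
                    + sqrt 2 / 2 * R * norm Lg)\<^sup>2"
  shows "(\<forall>t\<ge>1. F (xbar t) \<le> F xstar + \<alpha>max / real t * R\<^sup>2 \<and>
            (\<forall>k. G (xbar t) $ k \<le> 1 / real t * (2 * norm lam + R * sqrt (2 * \<alpha>max) + C))) \<and>
         (\<exists>K::real. \<forall>\<epsilon>>0. \<forall>t\<ge>1. real t \<ge> K / \<epsilon> \<longrightarrow>
            F (xbar t) \<le> F xstar + \<epsilon> \<and> (\<forall>k. G (xbar t) $ k \<le> \<epsilon>))"
proof -
  \<comment> \<open>With the iterates shifted by one, the initial point is \<open>p 0\<close>, and step \<open>t\<close> leads from \<open>p t\<close> to
    \<open>p (Suc t)\<close> for \<open>t = 0\<close> as well.\<close>
  define p where "p = prev x_init x"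
  have p_Suc: "p (Suc t) = x t" for t by (simp add: p_def prev_def)
  have p_0: "p 0 = x_init" by (simp add: p_def prev_def)
  have arg_min: "is_arg_min (step_objective Df ft Dg gt G (Q t) (\<alpha> t) (p t)) (\<lambda>y. y \<in> X) (x t)" for t
    using run by (simp add: algorithm_run_def p_def)
  have p_in: "p t \<in> X" for t
    using run by (cases t) (auto simp: p_Suc p_0 algorithm_run_def is_arg_min_def)
  have queue: "virtual_queue (\<lambda>t. G (p t)) Q"
    using run by (simp add: virtual_queue_def algorithm_run_def p_Suc p_0)
  have xbar: "xbar t = (1 / real t) *\<^sub>R (\<Sum>\<tau><t. p (Suc \<tau>))" if "0 < t" for t
    using run that
    by (cases t) (auto simp: algorithm_run_def p_Suc atLeast0AtMost lessThan_Suc_atMost)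
  have \<alpha>_Suc: "\<alpha> (Suc t) =
      max (\<alpha> t) (1/2 * (\<beta>\<^sup>2 + Lf + (Q (Suc t) + G (p (Suc t))) \<bullet> Lg))" for t
    using \<alpha>_step[of "Suc t"] by (simp add: p_Suc)
  have \<alpha>_ge: "1/2 * (\<beta>\<^sup>2 + Lf + (Q t + G (p t)) \<bullet> Lg) \<le> \<alpha> t" for t
    by (cases t) (auto simp: \<alpha>_0 p_0 \<alpha>_Suc)
  have \<alpha>_mono: "\<alpha> t \<le> \<alpha> (Suc t)" for t by (simp add: \<alpha>_Suc)
  have \<alpha>_pos: "0 < \<alpha> t" for t using run by (simp add: algorithm_run_def)
  have xstar_in: "xstar \<in> X" and xstar_feasible: "\<And>k. G xstar $ k \<le> 0"
    using xstar by (auto simp: is_arg_min_def feasible_def)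
  have lam_nonneg: "\<And>k. 0 \<le> lam $ k" using lam by (simp add: attains_strong_duality_def)
  \<comment> \<open>The primal and the dual minimum agree, so \<open>F xstar\<close> bounds the Lagrangian from below on all of \<open>X\<close>,
    in particular at the iterates, which may be infeasible.\<close>
  have dual: "F xstar \<le> F z + lam \<bullet> G z" if "z \<in> X" for z
  proof -
    obtain y y' where
      "is_arg_min (\<lambda>x. F x + (\<Sum>k\<in>UNIV. lam $ k * G x $ k)) (\<lambda>x. x \<in> X) y"
      "is_arg_min F (\<lambda>x. x \<in> feasible X G) y'"
      "F y' = F y + (\<Sum>k\<in>UNIV. lam $ k * G y $ k)"
      using lam by (auto simp: attains_strong_duality_def is_dual_value_def is_min_value_def)
    moreover from this xstar have "F xstar \<le> F y'" by (auto simp: is_arg_min_linorder)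
    ultimately show ?thesis using that by (fastforce simp: is_arg_min_linorder inner_vec_def)
  qed
  define d where "d t = (norm (xstar - p t))\<^sup>2" for t

  have step: "F (p (Suc t)) + (norm (Q (Suc t)))\<^sup>2 / 2 - (norm (Q t))\<^sup>2 / 2
      \<le> F xstar + \<alpha> t * (d t - d (Suc t)) + (norm (G (p (Suc t))))\<^sup>2 / 2 - (norm (G (p t)))\<^sup>2 / 2"
    for t
  proof -
    have w: "0 \<le> Q t $ k + G (p t) $ k" for k
      using virtual_queue_nonneg_compensated[OF queue] by blast
    have "f (x t) + ft (x t) + (Q t + G (p t)) \<bullet> G (x t) + \<beta>\<^sup>2 / 2 * (norm (x t - p t))\<^sup>2
        \<le> f xstar + ft xstar + (Q t + G (p t)) \<bullet> G xstar
          + \<alpha> t * ((norm (xstar - p t))\<^sup>2 - (norm (xstar - x t))\<^sup>2)"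
      using f ft(1) g(1,3) gt(1) G w \<alpha>_ge arg_min p_in xstar_in by (rule step_descent)
    moreover have "(Q t + G (p t)) \<bullet> G xstar \<le> 0"
      unfolding inner_vec_def using w xstar_feasible
      by (auto intro!: sum_nonpos mult_nonneg_nonpos)
    ultimately have 1: "F (p (Suc t)) + Q t \<bullet> G (p (Suc t)) + G (p t) \<bullet> G (p (Suc t))
        + \<beta>\<^sup>2 / 2 * (norm (p (Suc t) - p t))\<^sup>2 \<le> F xstar + \<alpha> t * (d t - d (Suc t))"
      by (simp add: F d_def p_Suc inner_add_left)
    \<comment> \<open>The mixed inner product left over from the weights is half the sum of the squared norms minus
      half the squared variation of \<open>G\<close>, and the \<open>\<beta>\<^sup>2 / 2\<close> term pays for the variation.\<close>
    have "(norm (G (p (Suc t)) - G (p t)))\<^sup>2 \<le> (\<beta> * norm (p (Suc t) - p t))\<^sup>2"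
      using \<beta> p_in by (intro power_mono) auto
    then have 2: "(norm (G (p (Suc t))))\<^sup>2 / 2 + (norm (G (p t)))\<^sup>2 / 2
        \<le> G (p t) \<bullet> G (p (Suc t)) + \<beta>\<^sup>2 / 2 * (norm (p (Suc t) - p t))\<^sup>2"
      unfolding power_mult_distrib
      by (simp add: power2_norm_eq_inner inner_diff_left inner_diff_right inner_commute)
    show ?thesis using 1 2 virtual_queue_drift[OF queue, of t] by simp
  qed

  have "(\<Sum>\<tau><t. F (p (Suc \<tau>))) + (norm (Q t))\<^sup>2 / 2 - (norm (Q 0))\<^sup>2 / 2
      \<le> real t * F xstar + (\<Sum>\<tau><t. \<alpha> \<tau> * (d \<tau> - d (Suc \<tau>)))
        + (norm (G (p t)))\<^sup>2 / 2 - (norm (G (p 0)))\<^sup>2 / 2" for t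
  proof (induction t)
    case (Suc t)
    then show ?case using step[of t] by (simp add: algebra_simps)
  qed simp
  moreover have "(norm (Q 0))\<^sup>2 \<le> (norm (G (p 0)))\<^sup>2"
    using virtual_queue_initial_norm[OF queue] by (intro power_mono) auto
  moreover have "(\<Sum>\<tau><Suc t. \<alpha> \<tau> * (d \<tau> - d (Suc \<tau>))) \<le> \<alpha> t * R\<^sup>2" for t
    using \<alpha>_mono less_imp_le[OF \<alpha>_pos] R xstar_in p_in
    by (intro weighted_telescope_le) (auto simp: d_def intro!: power_mono)
  ultimately have total: "(\<Sum>\<tau><Suc t. F (p (Suc \<tau>))) + (norm (Q (Suc t)))\<^sup>2 / 2
      \<le> real (Suc t) * F xstar + \<alpha> t * R\<^sup>2 + (norm (G (p (Suc t))))\<^sup>2 / 2" for t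
    by (smt (verit) divide_right_mono)

  \<comment> \<open>\<open>total\<close> bounds the accumulated objective from above, duality bounds it from below.\<close>
  have queue_bound: "norm (Q (Suc t)) \<le> 2 * norm lam + R * sqrt (2 * \<alpha> t) + C" for t
  proof -
    have "real (Suc t) * F xstar = (\<Sum>\<tau><Suc t. F xstar)" by simp
    also have "\<dots> \<le> (\<Sum>\<tau><Suc t. F (p (Suc \<tau>)) + lam \<bullet> G (p (Suc \<tau>)))"
      by (intro sum_mono dual p_in)
    also have "\<dots> = (\<Sum>\<tau><Suc t. F (p (Suc \<tau>))) + lam \<bullet> (\<Sum>\<tau><Suc t. G (p (Suc \<tau>)))"
      by (simp only: sum.distrib inner_sum_right)
    also have "lam \<bullet> (\<Sum>\<tau><Suc t. G (p (Suc \<tau>))) \<le> lam \<bullet> Q (Suc t)"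
      unfolding inner_vec_def inner_real_def sum_component
      by (intro sum_mono mult_left_mono virtual_queue_sum_le[OF queue] lam_nonneg)
    also have "\<dots> \<le> norm lam * norm (Q (Suc t))" by (rule norm_cauchy_schwarz)
    finally have "(norm (Q (Suc t)))\<^sup>2 / 2
        \<le> norm lam * norm (Q (Suc t)) + \<alpha> t * R\<^sup>2 + (norm (G (p (Suc t))))\<^sup>2 / 2"
      using total[of t] by simp
    moreover have "(norm (G (p (Suc t))))\<^sup>2 \<le> C\<^sup>2"
      using C p_in by (intro power_mono) auto
    ultimately have "(norm (Q (Suc t)))\<^sup>2 / 2
        \<le> norm lam * norm (Q (Suc t)) + \<alpha> t * R\<^sup>2 + C\<^sup>2 / 2" by simp
    then show ?thesis
      by (rule quadratic_inequality_bound) (use R C \<alpha>_pos[of t] in auto)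
  qed

  define A where "A = 1/2 * \<beta>\<^sup>2 + 1/2 * Lf + norm lam * norm Lg + C * norm Lg"
  have "0 \<le> Lf" using f(2) by (auto simp: smooth_with_gradient_def lipschitz_on_def)
  then have "0 \<le> A" using C by (simp add: A_def)
  then have invariant: "A + R * sqrt (2 * \<alpha>max) / 2 * norm Lg \<le> \<alpha>max"
    using R by (intro step_bound_invariant) (auto simp: \<alpha>max A_def)
  have "0 \<le> \<alpha>max" by (simp add: \<alpha>max)
  have candidate: "1/2 * (\<beta>\<^sup>2 + Lf + (Q t + G (p t)) \<bullet> Lg) \<le> \<alpha>max"
    if "norm (Q t) \<le> 2 * norm lam + R * sqrt (2 * \<alpha>max) + C" for t
  proof -
    have "(Q t + G (p t)) \<bullet> Lg \<le> norm (Q t + G (p t)) * norm Lg" by (rule norm_cauchy_schwarz)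
    also have "\<dots> \<le> (2 * norm lam + R * sqrt (2 * \<alpha>max) + C + C) * norm Lg"
      using that C(2)[OF p_in[of t]] by (intro mult_right_mono norm_triangle_le) auto
    finally show ?thesis using invariant by (simp add: A_def algebra_simps)
  qed
  \<comment> \<open>Each new candidate for the step parameter is controlled by the queue, and the queue by the previous
    step parameter.\<close>
  have \<alpha>_le: "\<alpha> t \<le> \<alpha>max" for t
  proof (induction t)
    case 0
    have "norm (Q 0) \<le> C"
      using virtual_queue_initial_norm[OF queue] C(2)[OF p_in] order_trans by blast
    then have "norm (Q 0) \<le> 2 * norm lam + R * sqrt (2 * \<alpha>max) + C"
      using R \<open>0 \<le> \<alpha>max\<close> by (simp add: add_increasing)
    then show ?case using candidate[of 0] by (simp add: \<alpha>_0 p_0)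
  next
    case (Suc t)
    have "R * sqrt (2 * \<alpha> t) \<le> R * sqrt (2 * \<alpha>max)" using Suc R by simp
    then show ?case using Suc candidate[of "Suc t"] queue_bound[of t] by (simp add: \<alpha>_Suc)
  qed

  define B where "B = 2 * norm lam + R * sqrt (2 * \<alpha>max) + C"
  have obj: "F (xbar t) \<le> F xstar + \<alpha>max / real t * R\<^sup>2" if "t \<ge> 1" for t
  proof -
    from that obtain s where t: "t = Suc s" by (cases t) auto
    have "(norm (G (p (Suc s))))\<^sup>2 \<le> (norm (Q (Suc s)))\<^sup>2"
      using virtual_queue_dominates[OF queue] by (intro power_mono) auto
    moreover have "\<alpha> s * R\<^sup>2 \<le> \<alpha>max * R\<^sup>2" using \<alpha>_le by (intro mult_right_mono) auto
    ultimately have sum: "(\<Sum>\<tau><t. F (p (Suc \<tau>))) \<le> real t * F xstar + \<alpha>max * R\<^sup>2"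
      using total[of s] unfolding t by linarith
    have "convex_on X (\<lambda>x. f x + ft x)" using f ft by (intro convex_on_add) auto
    then have "convex_on X F" by (simp add: F[abs_def])
    then have "F (xbar t) \<le> (1 / real t) * (\<Sum>\<tau><t. F (p (Suc \<tau>)))"
      using that p_in by (simp only: xbar) (intro convex_on_average, auto)
    also have "\<dots> \<le> (1 / real t) * (real t * F xstar + \<alpha>max * R\<^sup>2)"
      using sum by (intro mult_left_mono) auto
    finally show ?thesis using that by (simp add: field_simps)
  qed
  have con: "G (xbar t) $ k \<le> 1 / real t * B" if "t \<ge> 1" for t k
  proof -
    from that obtain s where t: "t = Suc s" by (cases t) auto
    have "convex_on X (\<lambda>x. g k x + gt k x)" using g gt by (intro convex_on_add) auto
    then have "convex_on X (\<lambda>x. G x $ k)" by (simp add: G)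
    then have "G (xbar t) $ k \<le> (1 / real t) * (\<Sum>\<tau><t. G (p (Suc \<tau>)) $ k)"
      using that p_in convex_on_average[where h = "\<lambda>x. G x $ k" and p = "\<lambda>\<tau>. p (Suc \<tau>)"]
      by (simp add: xbar)
    also have "\<dots> \<le> (1 / real t) * B"
    proof (intro mult_left_mono)
      have "(\<Sum>\<tau><t. G (p (Suc \<tau>)) $ k) \<le> Q t $ k" by (rule virtual_queue_sum_le[OF queue])
      also have "\<dots> \<le> norm (Q t)" using component_le_norm_cart[of "Q t" k] by linarith
      also have "\<dots> \<le> 2 * norm lam + R * sqrt (2 * \<alpha> s) + C"
        unfolding t by (rule queue_bound)
      also have "\<dots> \<le> B" using R \<alpha>_le[of s] by (simp add: B_def)
      finally show "(\<Sum>\<tau><t. G (p (Suc \<tau>)) $ k) \<le> B" .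
    qed simp
    finally show ?thesis .
  qed
  have "F (xbar t) \<le> F xstar + \<epsilon> \<and> (\<forall>k. G (xbar t) $ k \<le> \<epsilon>)"
    if "\<epsilon> > 0" "t \<ge> 1" and t: "max (\<alpha>max * R\<^sup>2) B / \<epsilon> \<le> real t" for \<epsilon> t
  proof -
    have "max (\<alpha>max * R\<^sup>2) B \<le> \<epsilon> * real t" using t that by (simp add: field_simps)
    then have "\<alpha>max / real t * R\<^sup>2 \<le> \<epsilon>" "1 / real t * B \<le> \<epsilon>"
      using that by (auto simp: divide_le_eq)
    then show ?thesis using obj con that by (meson add_left_mono order_trans)
  qed
  then show ?thesis using obj con unfolding B_def by blast
qed

end
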